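(* Let $\boldsymbol{P}\in\mathbb{R}^{[3,n]}$ be a stochastic tensor. If $\mathcal{T}_L(\boldsymbol{P})+\mathcal{T}_R(\boldsymbol{P})<1$ then the spacey random walk $$x_{t+1}=\boldsymbol{P}x_ty_t,\qquad y_{t+1}=\frac{1}{t+1}x_t+\frac{t}{t+1}y_t,\qquad t=0,1,2,\dots$$ converges globally, i.e., for any starting points $x_0,y_0\in\mathcal{S}_1$ we have $$\lim_{t\to\infty}\|x_t-x\|_1=\lim_{t\to\infty}\|y_t-x\|_1=0,$$ where $x$ is the unique solution in $\mathcal{S}_1$ of $x=\boldsymbol{P}xx$.
   Context: $\mathbb{R}^{[3,n]}$ is the set of real $n\times n\times n$ arrays $\boldsymbol{P}=(\boldsymbol{P}_{ijk})$, $n\ge 2$. $\boldsymbol{P}$ is called stochastic if $\boldsymbol{P}_{ijk}\ge 0$ for all $i,j,k$ and $\sum_{i=1}^n\boldsymbol{P}_{ijk}=1$ for all $j,k$. For $x,y\in\mathbb{R}^n$, $(\boldsymbol{P}xy)_i=\sum_{j,k}\boldsymbol{P}_{ijk}x_jy_k$. Let $\mathcal{S}_1=\{x\in\mathbb{R}^n: x\ge 0,\ \|x\|_1=1\}$ and $\mathcal{Z}_1=\{x\in\mathbb{R}^n:\sum_i x_i=0,\ \|x\|_1=1\}$. Definitions: $\mathcal{T}_L(\boldsymbol{P})=\max_{x\in\mathcal{S}_1}\max_{y\in\mathcal{Z}_1}\|\boldsymbol{P}xy\|_1$ and $\mathcal{T}_R(\boldsymbol{P})=\max_{x\in\mathcal{S}_1}\max_{y\in\mathcal{Z}_1}\|\boldsymbol{P}yx\|_1$.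 *)

theory Defs
  imports "HOL-Analysis.Analysis"
begin

text \<open>
  An order-three tensor is an element of \<^typ>\<open>real^'n^'n^'n\<close>, with entries \<open>P $ i $ j $ k\<close>.
  The library norm on \<^typ>\<open>real^'n\<close> is the Euclidean one, so the 1-norm is introduced separately.
\<close>

definition norm1 :: "real^'n \<Rightarrow> real" where
  "norm1 x = (\<Sum>i\<in>UNIV. \<bar>x $ i\<bar>)"

definition stochastic_tensor :: "real^'n^'n^'n \<Rightarrow> bool" where
  "stochastic_tensor P \<longleftrightarrow>
     (\<forall>i j k. 0 \<le> P $ i $ j $ k) \<and> (\<forall>j k. (\<Sum>i\<in>UNIV. P $ i $ j $ k) = 1)"

definition tensor_apply :: "real^'n^'n^'n \<Rightarrow> real^'n \<Rightarrow> real^'n \<Rightarrow> real^'n" where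
  "tensor_apply P x y = (\<chi> i. \<Sum>j\<in>UNIV. \<Sum>k\<in>UNIV. P $ i $ j $ k * x $ j * y $ k)"

definition S1 :: "(real^'n) set" where
  "S1 = {x. (\<forall>i. 0 \<le> x $ i) \<and> norm1 x = 1}"

definition Z1 :: "(real^'n) set" where
  "Z1 = {x. (\<Sum>i\<in>UNIV. x $ i) = 0 \<and> norm1 x = 1}"

text \<open>
  Maxima are written as suprema in \<^typ>\<open>real\<close>. They are attained when the index type has at
  least two elements (then \<open>Z1\<close> is nonempty); see \<open>T_L_attained\<close> and \<open>T_R_attained\<close> below.
\<close>

definition T_L :: "real^'n^'n^'n \<Rightarrow> real" where
  "T_L P = (SUP x\<in>S1. SUP y\<in>Z1. norm1 (tensor_apply P x y))"

definition T_R :: "real^'n^'n^'n \<Rightarrow> real" where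
  "T_R P = (SUP x\<in>S1. SUP y\<in>Z1. norm1 (tensor_apply P y x))"

definition spacey_random_walk ::
  "real^'n^'n^'n \<Rightarrow> (nat \<Rightarrow> real^'n) \<Rightarrow> (nat \<Rightarrow> real^'n) \<Rightarrow> bool" where
  "spacey_random_walk P x y \<longleftrightarrow>
     (\<forall>t. x (Suc t) = tensor_apply P (x t) (y t) \<and>
          y (Suc t) = (1 / (real t + 1)) *\<^sub>R x t + (real t / (real t + 1)) *\<^sub>R y t)"

lemma continuous_on_norm1 [continuous_intros]:
  "continuous_on A f \<Longrightarrow> continuous_on A (\<lambda>z. norm1 (f z))"
  unfolding norm1_def by (intro continuous_intros)

lemma continuous_on_tensor_apply [continuous_intros]:
  "continuous_on A f \<Longrightarrow> continuous_on A g \<Longrightarrow> continuous_on A (\<lambda>z. tensor_apply P (f z) (g z))"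
  unfolding tensor_apply_def by (intro continuous_intros)

lemma compact_norm1_sphere: "compact {x :: real^'n. norm1 x = 1}"
proof -
  have "closed {x :: real^'n. norm1 x = 1}"
    by (intro closed_Collect_eq continuous_intros)
  moreover have "bounded {x :: real^'n. norm1 x = 1}"
    unfolding bounded_iff by (rule exI[of _ 1]) (auto simp: norm1_def intro: order_trans[OF norm_le_l1_cart])
  ultimately show ?thesis by (simp add: compact_eq_bounded_closed)
qed

lemma compact_S1: "compact (S1 :: (real^'n) set)"
proof -
  have "closed {x :: real^'n. \<forall>i. 0 \<le> x $ i}"
    by (intro closed_Collect_all closed_Collect_le continuous_intros)
  moreover have "S1 = {x :: real^'n. \<forall>i. 0 \<le> x $ i} \<inter> {x. norm1 x = 1}"
    by (auto simp: S1_def)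
  ultimately show ?thesis
    using closed_Int_compact[OF _ compact_norm1_sphere] by metis
qed

lemma compact_Z1: "compact (Z1 :: (real^'n) set)"
proof -
  have "closed {x :: real^'n. (\<Sum>i\<in>UNIV. x $ i) = 0}"
    by (intro closed_Collect_eq continuous_intros)
  moreover have "Z1 = {x :: real^'n. (\<Sum>i\<in>UNIV. x $ i) = 0} \<inter> {x. norm1 x = 1}"
    by (auto simp: Z1_def)
  ultimately show ?thesis
    using closed_Int_compact[OF _ compact_norm1_sphere] by metis
qed

lemma S1_nonempty: "(S1 :: (real^'n) set) \<noteq> {}"
proof -
  have "axis undefined 1 \<in> (S1 :: (real^'n) set)"
    by (auto simp: S1_def norm1_def axis_def if_distrib cong: if_cong)
  then show ?thesis by auto
qed

lemma Z1_nonempty: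
  assumes "CARD('n) \<ge> 2"
  shows "(Z1 :: (real^'n) set) \<noteq> {}"
proof -
  obtain a b :: 'n where ab: "a \<noteq> b"
    using assms by (metis UNIV_I card_le_Suc0_iff_eq finite_code not_less_eq_eq numeral_2_eq_2)
  define x :: "real^'n" where "x = (\<chi> i. if i = a then 1/2 else if i = b then -1/2 else 0)"
  have "(\<Sum>i\<in>UNIV. x $ i) = (\<Sum>i\<in>{a,b}. x $ i)" "norm1 x = (\<Sum>i\<in>{a,b}. \<bar>x $ i\<bar>)"
    unfolding norm1_def by (rule sum.mono_neutral_right; auto simp: x_def)+
  then have "x \<in> Z1" using ab by (auto simp: Z1_def x_def)
  then show ?thesis by auto
qed

lemma nested_SUP_attained:
  fixes f :: "'a::t2_space \<Rightarrow> 'b::t2_space \<Rightarrow> real"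
  assumes A: "compact A" "A \<noteq> {}" and B: "compact B" "B \<noteq> {}"
    and cont: "continuous_on (A \<times> B) (\<lambda>z. f (fst z) (snd z))"
  obtains a b where "a \<in> A" "b \<in> B" "(SUP x\<in>A. SUP y\<in>B. f x y) = f a b"
    "\<And>x y. x \<in> A \<Longrightarrow> y \<in> B \<Longrightarrow> f x y \<le> f a b"
proof -
  obtain z where z: "z \<in> A \<times> B" and max: "\<And>w. w \<in> A \<times> B \<Longrightarrow> f (fst w) (snd w) \<le> f (fst z) (snd z)"
    using continuous_attains_sup[OF compact_Times[OF A(1) B(1)] _ cont] A B by fastforce
  obtain a b where ab: "z = (a, b)" "a \<in> A" "b \<in> B" using z by auto
  have le: "f x y \<le> f a b" if "x \<in> A" "y \<in> B" for x y
    using max[of "(x, y)"] that ab by simp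
  have inner: "(SUP y\<in>B. f x y) \<le> f a b" if "x \<in> A" for x
    using B le that by (intro cSUP_least) auto
  have "f a b \<le> (SUP y\<in>B. f a y)"
    using ab le by (intro cSUP_upper bdd_aboveI2[where M = "f a b"]) auto
  also have "\<dots> \<le> (SUP x\<in>A. SUP y\<in>B. f x y)"
    using ab inner by (intro cSUP_upper bdd_aboveI2[where M = "f a b"]) auto
  finally have "(SUP x\<in>A. SUP y\<in>B. f x y) = f a b"
    using cSUP_least[OF A(2) inner] by (intro antisym)
  then show thesis using that ab le by blast
qed

lemma T_L_attained:
  fixes P :: "real^'n^'n^'n"
  assumes "CARD('n) \<ge> 2"
  obtains x y where "x \<in> S1" "y \<in> Z1" "T_L P = norm1 (tensor_apply P x y)"
    "\<And>u v. u \<in> S1 \<Longrightarrow> v \<in> Z1 \<Longrightarrow> norm1 (tensor_apply P u v) \<le> T_L P"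
  by (rule nested_SUP_attained[OF compact_S1 S1_nonempty compact_Z1 Z1_nonempty[OF assms],
        where f = "\<lambda>x y. norm1 (tensor_apply P x y)"])
     (auto simp: T_L_def intro!: continuous_intros that)

lemma T_R_attained:
  fixes P :: "real^'n^'n^'n"
  assumes "CARD('n) \<ge> 2"
  obtains x y where "x \<in> S1" "y \<in> Z1" "T_R P = norm1 (tensor_apply P y x)"
    "\<And>u v. u \<in> S1 \<Longrightarrow> v \<in> Z1 \<Longrightarrow> norm1 (tensor_apply P v u) \<le> T_R P"
  by (rule nested_SUP_attained[OF compact_S1 S1_nonempty compact_Z1 Z1_nonempty[OF assms],
        where f = "\<lambda>x y. norm1 (tensor_apply P y x)"])
     (auto simp: T_R_def intro!: continuous_intros that)

end

theory Submission
  imports Defs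
begin

text \<open>
  The numbers \<open>T_L P\<close> and \<open>T_R P\<close> are Lipschitz constants of \<open>tensor_apply P\<close> on the simplex in its
  second and first argument, so \<open>x \<mapsto> P x x\<close> contracts the compact set \<open>S1\<close>, which gives the fixed
  point. Write \<open>L\<close>, \<open>R\<close> for the two constants and \<open>a\<^sub>t\<close>, \<open>b\<^sub>t\<close> for the distances of \<open>x\<^sub>t\<close>, \<open>y\<^sub>t\<close> to the
  fixed point. Then \<open>a\<^sub>t\<^sub>+\<^sub>1 \<le> R a\<^sub>t + L b\<^sub>t\<close> and \<open>(t + 1) b\<^sub>t\<^sub>+\<^sub>1 \<le> a\<^sub>t + t b\<^sub>t\<close>, hence
  \<open>W\<^sub>t = t b\<^sub>t + a\<^sub>t / (1 - R)\<close> satisfies \<open>W\<^sub>t\<^sub>+\<^sub>1 \<le> (1 + \<rho> / t) W\<^sub>t\<close> with \<open>\<rho> = L / (1 - R) < 1\<close>.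
  Thus \<open>W\<^sub>t / t\<close> is multiplied by at most \<open>1 - (1 - \<rho>) / (t + 1)\<close> in each step and tends to zero
  because the harmonic series diverges.
\<close>

section \<open>The 1-norm and the simplex\<close>

lemma norm1_nonneg [simp]: "0 \<le> norm1 x"
  by (simp add: norm1_def sum_nonneg)

lemma norm1_zero [simp]: "norm1 0 = 0"
  by (simp add: norm1_def)

lemma norm1_eq_0_iff [simp]: "norm1 x = 0 \<longleftrightarrow> x = 0"
  by (auto simp: norm1_def sum_nonneg_eq_0_iff vec_eq_iff)

lemma norm1_add_le: "norm1 (x + y) \<le> norm1 x + norm1 y"
  by (simp add: norm1_def flip: sum.distrib) (intro sum_mono abs_triangle_ineq)

lemma norm1_scaleR [simp]: "norm1 (c *\<^sub>R x) = \<bar>c\<bar> * norm1 x"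
  by (simp add: norm1_def abs_mult sum_distrib_left)

lemma S1_iff: "x \<in> S1 \<longleftrightarrow> (\<forall>i. 0 \<le> x $ i) \<and> (\<Sum>i\<in>UNIV. x $ i) = 1"
  unfolding S1_def norm1_def by auto

lemma convex_S1: "convex (S1 :: (real^'n) set)"
  by (auto simp: convex_def S1_iff sum.distrib simp flip: sum_distrib_left)

section \<open>Lipschitz estimates for stochastic tensors\<close>

lemma tensor_apply_diff_left: "tensor_apply P (x - y) z = tensor_apply P x z - tensor_apply P y z"
  by (simp add: tensor_apply_def vec_eq_iff algebra_simps sum_subtractf)

lemma tensor_apply_diff_right: "tensor_apply P z (x - y) = tensor_apply P z x - tensor_apply P z y"
  by (simp add: tensor_apply_def vec_eq_iff algebra_simps sum_subtractf)

lemma tensor_apply_scaleR_left: "tensor_apply P (c *\<^sub>R x) y = c *\<^sub>R tensor_apply P x y"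
  by (simp add: tensor_apply_def vec_eq_iff sum_distrib_left mult_ac)

lemma tensor_apply_scaleR_right: "tensor_apply P x (c *\<^sub>R y) = c *\<^sub>R tensor_apply P x y"
  by (simp add: tensor_apply_def vec_eq_iff sum_distrib_left mult_ac)

lemma tensor_apply_S1:
  assumes "stochastic_tensor P" "x \<in> S1" "y \<in> S1"
  shows "tensor_apply P x y \<in> S1"
proof -
  \<comment> \<open>The sum over \<open>i\<close> is moved innermost, where stochasticity replaces
    it by 1.\<close>
  have "(\<Sum>i\<in>UNIV. tensor_apply P x y $ i)
      = (\<Sum>j\<in>UNIV. \<Sum>i\<in>UNIV. \<Sum>k\<in>UNIV. P $ i $ j $ k * x $ j * y $ k)"
    unfolding tensor_apply_def by (simp, rule sum.swap)
  also have "\<dots> = (\<Sum>j\<in>UNIV. \<Sum>k\<in>UNIV. \<Sum>i\<in>UNIV. P $ i $ j $ k * x $ j * y $ k)"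
    by (intro sum.cong refl sum.swap)
  also have "\<dots> = (\<Sum>j\<in>UNIV. \<Sum>k\<in>UNIV. x $ j * y $ k)"
    using assms(1) by (simp add: stochastic_tensor_def flip: sum_distrib_right)
  also have "\<dots> = 1"
    using assms(2,3) by (simp add: S1_iff flip: sum_distrib_left)
  finally show ?thesis
    using assms by (auto simp: S1_iff stochastic_tensor_def tensor_apply_def intro!: sum_nonneg)
qed

text \<open>Two points of the simplex have equal coordinate sums. Normalizing their difference is
  what lets the maxima over \<open>Z1\<close> act as Lipschitz constants.\<close>

lemma sgn1_diff_in_Z1:
  assumes "x \<in> S1" "y \<in> S1" "x \<noteq> y"
  shows "(1 / norm1 (x - y)) *\<^sub>R (x - y) \<in> Z1"
  using assms by (auto simp: Z1_def S1_iff sum_subtractf simp flip: sum_divide_distrib)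

lemma norm1_tensor_apply_diff_right_le:
  fixes P :: "real^'n^'n^'n"
  assumes "CARD('n) \<ge> 2" "u \<in> S1" "x \<in> S1" "y \<in> S1"
  shows "norm1 (tensor_apply P u x - tensor_apply P u y) \<le> T_L P * norm1 (x - y)"
proof (cases "x = y")
  case False
  then have pos: "0 < norm1 (x - y)"
    by (simp add: order_less_le)
  have "norm1 (tensor_apply P u ((1 / norm1 (x - y)) *\<^sub>R (x - y))) \<le> T_L P"
    using T_L_attained[OF assms(1)] sgn1_diff_in_Z1[OF assms(3,4) False] assms(2) by metis
  then show ?thesis
    using pos unfolding tensor_apply_scaleR_right norm1_scaleR tensor_apply_diff_right
    by (simp add: field_simps)
qed simp

lemma norm1_tensor_apply_diff_left_le:
  fixes P :: "real^'n^'n^'n"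
  assumes "CARD('n) \<ge> 2" "u \<in> S1" "x \<in> S1" "y \<in> S1"
  shows "norm1 (tensor_apply P x u - tensor_apply P y u) \<le> T_R P * norm1 (x - y)"
proof (cases "x = y")
  case False
  then have pos: "0 < norm1 (x - y)"
    by (simp add: order_less_le)
  have "norm1 (tensor_apply P ((1 / norm1 (x - y)) *\<^sub>R (x - y)) u) \<le> T_R P"
    using T_R_attained[OF assms(1)] sgn1_diff_in_Z1[OF assms(3,4) False] assms(2) by metis
  then show ?thesis
    using pos unfolding tensor_apply_scaleR_left norm1_scaleR tensor_apply_diff_left
    by (simp add: field_simps)
qed simp

text \<open>One argument is changed at a time, passing through
  \<open>tensor_apply P x' y\<close>.\<close>

lemma norm1_tensor_apply_diff_le:
  fixes P :: "real^'n^'n^'n"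
  assumes "CARD('n) \<ge> 2" "x \<in> S1" "y \<in> S1" "x' \<in> S1" "y' \<in> S1"
  shows "norm1 (tensor_apply P x y - tensor_apply P x' y')
           \<le> T_R P * norm1 (x - x') + T_L P * norm1 (y - y')"
  using norm1_add_le[of "tensor_apply P x y - tensor_apply P x' y"
      "tensor_apply P x' y - tensor_apply P x' y'"]
    norm1_tensor_apply_diff_left_le[OF assms(1,3,2,4), of P]
    norm1_tensor_apply_diff_right_le[OF assms(1,4,3,5), of P]
  by simp

lemma tensor_apply_fixed_point_exists:
  fixes P :: "real^'n^'n^'n"
  assumes "CARD('n) \<ge> 2" "stochastic_tensor P" "T_L P + T_R P < 1"
  obtains x where "x \<in> S1" "x = tensor_apply P x x"
proof -
  \<comment> \<open>A minimizer of the displacement is fixed, since otherwise its image is displaced less.\<close>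
  have "continuous_on S1 (\<lambda>x. norm1 (tensor_apply P x x - x))"
    by (intro continuous_intros)
  then obtain x where x: "x \<in> S1"
    and min: "\<And>y. y \<in> S1 \<Longrightarrow> norm1 (tensor_apply P x x - x) \<le> norm1 (tensor_apply P y y - y)"
    using continuous_attains_inf[OF compact_S1 S1_nonempty] by meson
  let ?y = "tensor_apply P x x"
  have y: "?y \<in> S1"
    using tensor_apply_S1 assms(2) x by blast
  \<comment> \<open>Since \<open>?y\<close> is the image of \<open>x\<close>, its displacement is a
    difference of two tensor values, both of whose arguments move from \<open>x\<close> to
    \<open>?y\<close>.\<close>
  have "norm1 (?y - x) \<le> (T_L P + T_R P) * norm1 (?y - x)"
    using min[OF y] norm1_tensor_apply_diff_le[OF assms(1) y y x x, of P]
    by (simp add: distrib_right)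
  then have "norm1 (?y - x) = 0"
    using assms(3) by (smt (verit) mult_le_cancel_right1 norm1_nonneg)
  then show thesis
    using that x by simp
qed

section \<open>Coupled recursive inequalities\<close>

text \<open>By \<open>1 - s \<le> exp (- s)\<close> the product of the factors is at most the
  exponential of \<open>- \<delta>\<close> times a harmonic sum.\<close>

lemma tendsto_0_harmonic_contraction:
  fixes w :: "nat \<Rightarrow> real"
  assumes "0 < \<delta>" and nonneg: "\<And>t. 0 \<le> w t"
    and step: "\<And>t. w (Suc t) \<le> (1 - \<delta> / real (Suc t)) * w t"
  shows "w \<longlonglongrightarrow> 0"
proof -
  have bound: "w t \<le> w 0 * exp (- \<delta> * harm t)" for t
  proof (induction t)
    case (Suc t)
    have "w (Suc t) \<le> exp (- \<delta> / real (Suc t)) * w t"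
      using step[of t] exp_ge_add_one_self[of "- \<delta> / real (Suc t)"] nonneg[of t]
      by (smt (verit) minus_divide_left mult_right_mono)
    also have "\<dots> \<le> exp (- \<delta> / real (Suc t)) * (w 0 * exp (- \<delta> * harm t))"
      using Suc by (intro mult_left_mono) auto
    also have "\<dots> = w 0 * exp (- \<delta> * harm (Suc t))"
      by (simp add: harm_Suc field_simps flip: exp_add)
    finally show ?case .
  qed (simp add: harm_def)
  have "filterlim (\<lambda>t. - \<delta> * harm t :: real) at_bot sequentially"
    using assms(1) by (intro filterlim_tendsto_neg_mult_at_bot[OF tendsto_const _ harm_at_top]) simp
  then have "(\<lambda>t. w 0 * exp (- \<delta> * harm t)) \<longlonglongrightarrow> w 0 * 0"
    by (intro tendsto_mult tendsto_const filterlim_compose[OF exp_at_bot])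
  then have "(\<lambda>t. w 0 * exp (- \<delta> * harm t)) \<longlonglongrightarrow> 0"
    by simp
  then show ?thesis
    by (rule tendsto_sandwich[OF always_eventually[OF allI] always_eventually[OF allI] tendsto_const,
          OF nonneg bound])
qed

lemma tendsto_0_geometric_contraction:
  fixes a e :: "nat \<Rightarrow> real"
  assumes R: "0 \<le> R" "R < 1" and nonneg: "\<And>t. 0 \<le> a t"
    and step: "\<And>t. a (Suc t) \<le> R * a t + e t" and e: "e \<longlonglongrightarrow> 0"
  shows "a \<longlonglongrightarrow> 0"
proof (rule LIMSEQ_I)
  fix \<epsilon> :: real assume "0 < \<epsilon>"
  \<comment> \<open>With this bound on the perturbation, \<open>\<epsilon> / 2\<close> is the fixed
    point of the affine recursion, and the excess over it decays like \<open>R ^ k\<close>.\<close>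
  then have "0 < \<epsilon> / 2 * (1 - R)"
    using R by simp
  then obtain N where N: "\<And>t. t \<ge> N \<Longrightarrow> e t < \<epsilon> / 2 * (1 - R)"
    using order_tendstoD(2)[OF e] unfolding eventually_sequentially by metis
  have bound: "a (N + k) \<le> R ^ k * a N + \<epsilon> / 2" for k
  proof (induction k)
    case (Suc k)
    have "a (N + Suc k) \<le> R * a (N + k) + \<epsilon> / 2 * (1 - R)"
      using step[of "N + k"] N[of "N + k"] by simp
    also have "\<dots> \<le> R * (R ^ k * a N + \<epsilon> / 2) + \<epsilon> / 2 * (1 - R)"
      using Suc R by (intro add_right_mono mult_left_mono)
    also have "\<dots> = R ^ Suc k * a N + \<epsilon> / 2"
      by (simp add: diff_divide_distrib right_diff_distrib distrib_left mult_ac)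
    finally show ?case .
  qed (use \<open>0 < \<epsilon>\<close> in simp)
  have "(\<lambda>k. R ^ k * a N) \<longlonglongrightarrow> 0 * a N"
    using R by (intro tendsto_mult tendsto_const LIMSEQ_realpow_zero)
  then have "\<forall>\<^sub>F k in sequentially. R ^ k * a N < \<epsilon> / 2"
    using \<open>0 < \<epsilon>\<close> by (intro order_tendstoD(2)) auto
  then obtain M where M: "\<And>k. k \<ge> M \<Longrightarrow> R ^ k * a N < \<epsilon> / 2"
    unfolding eventually_sequentially by metis
  have "norm (a t - 0) < \<epsilon>" if "t \<ge> N + M" for t
  proof -
    have "a t \<le> R ^ (t - N) * a N + \<epsilon> / 2"
      using bound[of "t - N"] that by simp
    moreover have "R ^ (t - N) * a N < \<epsilon> / 2"
      using M that by simp
    ultimately show ?thesis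
      using nonneg[of t] by simp
  qed
  then show "\<exists>M. \<forall>t\<ge>M. norm (a t - 0) < \<epsilon>"
    by blast
qed

lemma tendsto_0_of_averaged_recursion:
  fixes a b :: "nat \<Rightarrow> real"
  assumes L: "0 \<le> L" and R: "0 \<le> R" and LR: "L + R < 1"
    and nonneg: "\<And>t. 0 \<le> a t" "\<And>t. 0 \<le> b t"
    and a: "\<And>t. a (Suc t) \<le> R * a t + L * b t"
    and b: "\<And>t. real (Suc t) * b (Suc t) \<le> a t + real t * b t"
  shows "a \<longlonglongrightarrow> 0" "b \<longlonglongrightarrow> 0"
proof -
  \<comment> \<open>This is the solution of \<open>1 + c * R = c\<close>, so that the weight of
    \<open>a\<close> in \<open>W\<close> reproduces itself in one step.\<close>
  define c where "c = 1 / (1 - R)"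
  have c: "0 < c" "1 + c * R = c"
    using L LR by (auto simp: c_def field_simps)
  define \<delta> where "\<delta> = 1 - c * L"
  \<comment> \<open>Positivity is exactly where \<open>L + R < 1\<close> enters: it says
    \<open>L / (1 - R) < 1\<close>.\<close>
  have \<delta>: "0 < \<delta>"
    using L LR by (simp add: c_def \<delta>_def field_simps)
  define W where "W t = real t * b t + c * a t" for t
  \<comment> \<open>The shift by one avoids division by zero at the start.\<close>
  define w where "w t = W (Suc t) / real (Suc t)" for t
  have W_nonneg: "0 \<le> W t" for t
    using c nonneg by (simp add: W_def)
  have b_le: "b (Suc t) \<le> w t" for t
    using c nonneg by (simp add: w_def W_def field_simps)
  have W_step: "W (Suc t) \<le> W t + (1 - \<delta>) * b t" for t
  proof -
    have "W (Suc t) \<le> (a t + real t * b t) + c * (R * a t + L * b t)"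
      unfolding W_def using c by (intro add_mono mult_left_mono a b) auto
    also have "\<dots> = real t * b t + (1 + c * R) * a t + c * L * b t"
      by (simp add: algebra_simps)
    finally show ?thesis
      unfolding c(2) by (simp add: W_def \<delta>_def)
  qed
  have "w (Suc t) \<le> (1 - \<delta> / real (Suc (Suc t))) * w t" for t
  proof -
    have "W (Suc (Suc t)) \<le> W (Suc t) + (1 - \<delta>) * w t"
      using W_step[of "Suc t"] b_le[of t] L c(1)
      by (smt (verit) \<delta>_def mult_left_mono mult_nonneg_nonneg)
    also have "\<dots> = (real (Suc (Suc t)) - \<delta>) * w t"
      by (simp add: w_def field_simps)
    finally have "W (Suc (Suc t)) / real (Suc (Suc t))
        \<le> (real (Suc (Suc t)) - \<delta>) * w t / real (Suc (Suc t))"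
      by (rule divide_right_mono) simp
    also have "\<dots> = (1 - \<delta> / real (Suc (Suc t))) * w t"
      by (simp add: diff_divide_distrib left_diff_distrib del: of_nat_Suc)
    finally show ?thesis
      by (simp only: w_def[of "Suc t"])
  qed
  \<comment> \<open>Halving the rate absorbs the index shift.\<close>
  moreover have "(1 - \<delta> / real (Suc (Suc t))) * w t \<le> (1 - \<delta> / 2 / real (Suc t)) * w t" for t
  proof (rule mult_right_mono)
    have "\<delta> / (2 * real (Suc t)) \<le> \<delta> / real (Suc (Suc t))"
      using \<delta> by (intro divide_left_mono) auto
    then show "1 - \<delta> / real (Suc (Suc t)) \<le> 1 - \<delta> / 2 / real (Suc t)"
      by simp
    show "0 \<le> w t"
      using W_nonneg by (simp add: w_def)
  qed
  ultimately have "w (Suc t) \<le> (1 - \<delta> / 2 / real (Suc t)) * w t" for t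
    using order_trans by blast
  then have "w \<longlonglongrightarrow> 0"
    using tendsto_0_harmonic_contraction[of "\<delta> / 2" w] \<delta> W_nonneg by (simp add: w_def)
  then have "(\<lambda>t. b (Suc t)) \<longlonglongrightarrow> 0"
    by (rule tendsto_sandwich[OF always_eventually[OF allI] always_eventually[OF allI] tendsto_const,
          OF nonneg(2) b_le])
  then show lim_b: "b \<longlonglongrightarrow> 0"
    by (simp only: filterlim_sequentially_Suc)
  \<comment> \<open>Once \<open>b\<close> vanishes, \<open>a\<close> obeys a geometric contraction
    with a vanishing perturbation.\<close>
  have "(\<lambda>t. L * b t) \<longlonglongrightarrow> 0"
    using tendsto_mult_right_zero[OF lim_b] .
  then show "a \<longlonglongrightarrow> 0"
    using L LR
    by (intro tendsto_0_geometric_contraction[where e = "\<lambda>t. L * b t", OF R _ nonneg(1) a]) auto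
qed

section \<open>Convergence of the spacey random walk\<close>

lemma spacey_random_walk_in_S1:
  assumes "stochastic_tensor P" "spacey_random_walk P xs ys" "xs 0 \<in> S1" "ys 0 \<in> S1"
  shows "xs t \<in> S1 \<and> ys t \<in> S1"
proof (induction t)
  case (Suc t)
  have "1 / (real t + 1) + real t / (real t + 1) = 1"
    by (simp add: field_simps)
  then have "(1 / (real t + 1)) *\<^sub>R xs t + (real t / (real t + 1)) *\<^sub>R ys t \<in> S1"
    using Suc by (intro convexD[OF convex_S1]) auto
  then show ?case
    using Suc assms by (simp add: spacey_random_walk_def tensor_apply_S1)
qed (use assms in simp)

lemma spacey_random_walk_converges:
  fixes P :: "real^'n^'n^'n"
  assumes "CARD('n) \<ge> 2" "stochastic_tensor P" "T_L P + T_R P < 1"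
    and x: "x \<in> S1" "x = tensor_apply P x x"
    and walk: "spacey_random_walk P xs ys" "xs 0 \<in> S1" "ys 0 \<in> S1"
  shows "(\<lambda>t. norm1 (xs t - x)) \<longlonglongrightarrow> 0" "(\<lambda>t. norm1 (ys t - x)) \<longlonglongrightarrow> 0"
proof -
  have in_S1: "xs t \<in> S1" "ys t \<in> S1" for t
    using spacey_random_walk_in_S1[OF assms(2) walk] by auto
  have nonneg: "0 \<le> T_L P" "0 \<le> T_R P"
    using T_L_attained[OF assms(1)] T_R_attained[OF assms(1)] norm1_nonneg by metis+
  have a: "norm1 (xs (Suc t) - x) \<le> T_R P * norm1 (xs t - x) + T_L P * norm1 (ys t - x)" for t
    using norm1_tensor_apply_diff_le[OF assms(1) in_S1(1)[of t] in_S1(2)[of t] x(1) x(1), of P]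
      walk(1) x(2) by (simp add: spacey_random_walk_def)
  have b: "real (Suc t) * norm1 (ys (Suc t) - x) \<le> norm1 (xs t - x) + real t * norm1 (ys t - x)" for t
  proof -
    \<comment> \<open>Clearing the denominator also covers \<open>t = 0\<close>, where
      \<open>ys 0\<close> has weight zero.\<close>
    have "real (Suc t) *\<^sub>R ys (Suc t) = xs t + real t *\<^sub>R ys t"
      using walk(1) by (simp add: spacey_random_walk_def scaleR_right_distrib add.commute)
    then have "real (Suc t) *\<^sub>R (ys (Suc t) - x) = (xs t - x) + real t *\<^sub>R (ys t - x)"
      by (simp add: algebra_simps)
    then show ?thesis
      using norm1_add_le[of "xs t - x" "real t *\<^sub>R (ys t - x)"]
      by (metis abs_of_nat norm1_scaleR)
  qed
  show "(\<lambda>t. norm1 (xs t - x)) \<longlonglongrightarrow> 0" "(\<lambda>t. norm1 (ys t - x)) \<longlonglongrightarrow> 0"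
    by (rule tendsto_0_of_averaged_recursion[OF nonneg assms(3) norm1_nonneg norm1_nonneg a b])+
qed

theorem corollary6p6:
  fixes P :: "real^'n^'n^'n"
  assumes "CARD('n) \<ge> 2"
    and "stochastic_tensor P"
    and "T_L P + T_R P < 1"
  shows "\<exists>x. (x \<in> S1 \<and> x = tensor_apply P x x \<and>
               (\<forall>z\<in>S1. z = tensor_apply P z z \<longrightarrow> z = x)) \<and>
             (\<forall>xs ys. spacey_random_walk P xs ys \<and> xs 0 \<in> S1 \<and> ys 0 \<in> S1 \<longrightarrow>
               (\<lambda>t. norm1 (xs t - x)) \<longlonglongrightarrow> 0 \<and> (\<lambda>t. norm1 (ys t - x)) \<longlonglongrightarrow> 0)"
proof -
  obtain x where x: "x \<in> S1" "x = tensor_apply P x x"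
    using tensor_apply_fixed_point_exists[OF assms] .
  have "z = x" if z: "z \<in> S1" "z = tensor_apply P z z" for z
  proof -
    \<comment> \<open>Both points equal their images, so their distance shrinks by a factor below 1
      and must be zero.\<close>
    have "norm1 (z - x) \<le> (T_L P + T_R P) * norm1 (z - x)"
      using norm1_tensor_apply_diff_le[OF assms(1) z(1) z(1) x(1) x(1), of P] x(2) z(2)
      by (simp add: distrib_right)
    then have "norm1 (z - x) = 0"
      using assms(3) by (smt (verit) mult_le_cancel_right1 norm1_nonneg)
    then show ?thesis
      by simp
  qed
  then show ?thesis
    using x spacey_random_walk_converges[OF assms x] by blast
qed

end
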